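(* Let $n\ge 3$ and $0\le k\le n-2$ be integers, and let $d>1$ be a divisor of $2^{n-k}-1$. Set $X=\{2^n-2^j : k\le j\le n\}$, $m=(2^{n+1}+d)+(2^n-2^k)$, $Y=m-X=\{m-x: x\in X\}$, $Z=\{2^n+jd : 1\le j\le (2^n-2^k)/d\}$, $B=X\sqcup Y\sqcup Z$, $a=2^n$, and $A=B\cup\{a\}$. Then $A$ is a normalised set with $|A+A|=|A-A|+1$ (in particular $|A+A|>|A-A|$).
   Context: For $A\subseteq\mathbb{Z}$, $A+A=\{a_1+a_2 : a_1,a_2\in A\}$ and $A-A=\{a_1-a_2 : a_1,a_2\in A\}$. A finite set $A\subseteq\mathbb{Z}$ is normalised if its smallest element is $0$ and the greatest common divisor of its elements is $1$. *)

theory Defs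
  imports Main
begin

definition sumset :: "int set \<Rightarrow> int set" where
  "sumset A = {a1 + a2 | a1 a2. a1 \<in> A \<and> a2 \<in> A}"

(* On sets, the library's minus is set difference, hence a separate constant. *)
definition diffset :: "int set \<Rightarrow> int set" where
  "diffset A = {a1 - a2 | a1 a2. a1 \<in> A \<and> a2 \<in> A}"

definition normalised :: "int set \<Rightarrow> bool" where
  "normalised A \<longleftrightarrow> finite A \<and> A \<noteq> {} \<and> Min A = 0 \<and> Gcd A = 1"

end

theory Submission
  imports Defs
begin

text \<open>
  The set \<open>B\<close> is symmetric: \<open>m - B = B\<close>. Hence \<open>B + B\<close> is a translate of \<open>B - B\<close>, and the
  inclusions \<open>a + B \<subseteq> B + B\<close>, \<open>B - a \<subseteq> B - B\<close> are equivalent. When they hold, adjoining \<open>a\<close>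
  to \<open>B\<close> creates no new difference, and the only possible new sum is \<open>2a\<close>. Here
  \<open>2a = 2\<^sup>n\<^sup>+\<^sup>1\<close> could only be a sum of elements of \<open>X\<close> and \<open>Z\<close>, which would make the odd number
  \<open>d > 1\<close> divide a power of two.
\<close>

lemma sumsetI: "x \<in> A \<Longrightarrow> y \<in> A \<Longrightarrow> x + y = s \<Longrightarrow> s \<in> sumset A"
  by (auto simp: sumset_def)

lemma diffsetI: "x \<in> A \<Longrightarrow> y \<in> A \<Longrightarrow> x - y = s \<Longrightarrow> s \<in> diffset A"
  by (auto simp: diffset_def)

lemma finite_diffset:
  assumes "finite A"
  shows "finite (diffset A)"
proof -
  have "diffset A = (\<lambda>(x, y). x - y) ` (A \<times> A)"
    by (auto simp: diffset_def)
  then show ?thesis using assms by simp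
qed

text \<open>Since \<open>x + y = m + (x - (m - y))\<close>, replacing the second summand by its
  reflection \<open>m - y\<close>, again in \<open>B\<close>, turns a sum into a difference shifted
  by \<open>m\<close>.\<close>

lemma sumset_symmetric:
  assumes sym: "\<And>b. b \<in> B \<Longrightarrow> m - b \<in> B"
  shows "sumset B = (+) m ` diffset B"
proof (intro set_eqI iffI)
  fix s assume "s \<in> sumset B"
  then obtain x y where xy: "x \<in> B" "y \<in> B" "s = x + y"
    by (auto simp: sumset_def)
  have "x - (m - y) \<in> diffset B"
    using xy sym by (blast intro: diffsetI)
  moreover have "s = m + (x - (m - y))" using xy by simp
  ultimately show "s \<in> (+) m ` diffset B" by blast
next
  fix s assume "s \<in> (+) m ` diffset B"
  then obtain x y where xy: "x \<in> B" "y \<in> B" "s = m + (x - y)"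
    by (auto simp: diffset_def)
  then show "s \<in> sumset B"
    using sym[of y] by (auto intro: sumsetI[of x B "m - y"])
qed

lemma card_sumset_insert_symmetric:
  assumes fin: "finite B" and ne: "B \<noteq> {}"
    and sym: "\<And>b. b \<in> B \<Longrightarrow> m - b \<in> B"
    and add: "\<And>b. b \<in> B \<Longrightarrow> a + b \<in> sumset B"
    and dbl: "2 * a \<notin> sumset B"
  shows "card (sumset (insert a B)) = card (diffset (insert a B)) + 1"
proof -
  have eq: "sumset B = (+) m ` diffset B"
    using sym by (rule sumset_symmetric)
  have neg: "- s \<in> diffset B" if "s \<in> diffset B" for s
    using that by (force simp: diffset_def)
  \<comment> \<open>\<open>add\<close> is applied to the reflected element:
    \<open>a + (m - b)\<close> lies in \<open>B + B\<close>, the translate of \<open>B - B\<close>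
    by \<open>m\<close>. Cancelling \<open>m\<close> leaves \<open>a - b\<close>, and difference
    sets are closed under negation.\<close>
  have sub: "b - a \<in> diffset B" if "b \<in> B" for b
  proof -
    have "a + (m - b) \<in> (+) m ` diffset B"
      using add[OF sym[OF that]] eq by simp
    then have "a - b \<in> diffset B" by auto
    from neg[OF this] show ?thesis by simp
  qed
  have sub': "a - b \<in> diffset B" if "b \<in> B" for b
    using neg[OF sub[OF that]] by simp
  \<comment> \<open>This takes care of the remaining difference \<open>a - a\<close>.\<close>
  have "0 \<in> diffset B" using ne by (force simp: diffset_def)
  then have D: "diffset (insert a B) = diffset B"
    using sub sub' by (auto simp: diffset_def)
  have S: "sumset (insert a B) = insert (2 * a) (sumset B)"
  proof (intro set_eqI iffI)
    fix s assume "s \<in> sumset (insert a B)"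
    then obtain x y where "x \<in> insert a B" "y \<in> insert a B" "s = x + y"
      by (auto simp: sumset_def)
    then show "s \<in> insert (2 * a) (sumset B)"
      using add[of x] add[of y] by (auto simp: add.commute intro: sumsetI)
  next
    fix s assume "s \<in> insert (2 * a) (sumset B)"
    then show "s \<in> sumset (insert a B)"
      using sumsetI[of a "insert a B" a] by (auto simp: sumset_def)
  qed
  have "card (sumset B) = card (diffset B)"
    unfolding eq by (rule card_image) simp
  moreover have "finite (sumset B)"
    unfolding eq using fin by (simp add: finite_diffset)
  ultimately show ?thesis using dbl by (simp add: S D)
qed

theorem theorem2:
  fixes n k :: nat and d m a :: int and X Y Z B A :: "int set"
  assumes "n \<ge> 3" and "k \<le> n - 2"
    and "d > 1" and "d dvd 2 ^ (n - k) - 1"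
    and "X = {2 ^ n - 2 ^ j | j :: nat. k \<le> j \<and> j \<le> n}"
    and "m = (2 ^ (n + 1) + d) + (2 ^ n - 2 ^ k)"
    and "Y = {m - x | x. x \<in> X}"
    and "Z = {2 ^ n + j * d | j :: int. 1 \<le> j \<and> j \<le> (2 ^ n - 2 ^ k) div d}"
    and "B = X \<union> Y \<union> Z"
    and "a = 2 ^ n"
    and "A = B \<union> {a}"
  shows "X \<inter> Y = {} \<and> X \<inter> Z = {} \<and> Y \<inter> Z = {}
    \<and> normalised A
    \<and> card (sumset A) = card (diffset A) + 1
    \<and> card (sumset A) > card (diffset A)"
proof -

  \<comment> \<open>Arithmetic of the parameters\<close>
  define M where "M = (2 ^ n - 2 ^ k) div d"
  have kn: "k < n" "k \<le> n - 1" "n - 1 < n" using assms(1,2) by auto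
  have d1: "d > 1" by fact
  have pk: "(0::int) < 2 ^ k" "(2::int) ^ k < 2 ^ n"
    using kn by auto
  have pow: "(2::int) ^ n - 2 ^ k = 2 ^ k * (2 ^ (n - k) - 1)"
    using kn by (simp add: right_diff_distrib flip: power_add)
  \<comment> \<open>The division is exact because \<open>d\<close> divides the second factor in
    \<open>pow\<close>. Thus \<open>Z\<close> has \<open>M\<close> terms and ends at
    \<open>2 ^ n + M * d\<close>.\<close>
  have Md: "M * d = 2 ^ n - 2 ^ k"
    unfolding M_def pow using assms(4) by simp
  have M1: "1 \<le> M"
  proof -
    have "0 < M * d" using Md pk by simp
    then show ?thesis using d1 by (simp add: zero_less_mult_iff)
  qed
  have m: "m = 2 * 2 ^ n + d + M * d" by (simp add: assms(6) Md)
  \<comment> \<open>A divisor of an odd number is odd, hence coprime to every power of two. Both the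
    gcd of \<open>A\<close> and the exclusion of \<open>2 * a\<close> rest on this.\<close>
  have oddd: "odd d"
  proof -
    have "n - k > 0" using kn by simp
    then have "odd ((2::int) ^ (n - k) - 1)" by simp
    then show ?thesis using assms(4) dvd_trans by blast
  qed
  then have cop: "coprime d (2 ^ j)" for j :: nat by simp
  have a: "a = 2 ^ n" by fact

  \<comment> \<open>The three pieces and their location\<close>
  have XI: "2 ^ n - 2 ^ j \<in> X" if "k \<le> j" "j \<le> n" for j
    using that assms(5) by blast
  have XE: "\<exists>j. k \<le> j \<and> j \<le> n \<and> x = 2 ^ n - 2 ^ j" if "x \<in> X" for x
    using that assms(5) by blast
  have ZI: "2 ^ n + j * d \<in> Z" if "1 \<le> j" "j \<le> M" for j
    using that assms(8) M_def by blast
  have ZE: "\<exists>j. 1 \<le> j \<and> j \<le> M \<and> z = 2 ^ n + j * d" if "z \<in> Z" for z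
    using that assms(8) M_def by blast
  have YI: "m - x \<in> Y" if "x \<in> X" for x
    using that assms(7) by blast
  have YE: "\<exists>x. x \<in> X \<and> y = m - x" if "y \<in> Y" for y
    using that assms(7) by blast
  have XB: "X \<subseteq> B" and YB: "Y \<subseteq> B" and ZB: "Z \<subseteq> B" using assms(9) by auto
  have X0: "0 \<in> X" using XI[of n] kn by simp

  \<comment> \<open>The bounds place \<open>X\<close> below \<open>2 ^ n\<close>, \<open>Z\<close>
    strictly between \<open>2 ^ n\<close> and \<open>2 * 2 ^ n\<close>, and \<open>Y\<close> beyond
    that. The bound \<open>x \<le> M * d\<close> is the one that locates \<open>Y\<close>, as
    \<open>m - M * d = 2 * 2 ^ n + d\<close>.\<close>
  have Xb: "0 \<le> x \<and> x < 2 ^ n \<and> x \<le> M * d" if "x \<in> X" for x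
  proof -
    obtain j where j: "k \<le> j" "j \<le> n" "x = 2 ^ n - 2 ^ j" using XE \<open>x \<in> X\<close> by blast
    have "(2::int) ^ j \<le> 2 ^ n" "(2::int) ^ k \<le> 2 ^ j" using j by auto
    then show ?thesis using j pk Md by auto
  qed
  have Yb: "2 * 2 ^ n < y" if "y \<in> Y" for y
  proof -
    obtain x where "x \<in> X" "y = m - x" using YE \<open>y \<in> Y\<close> by blast
    then show ?thesis using Xb[of x] m d1 by linarith
  qed
  have Zb: "2 ^ n < z \<and> z < 2 * 2 ^ n" if "z \<in> Z" for z
  proof -
    obtain j where j: "1 \<le> j" "j \<le> M" "z = 2 ^ n + j * d" using ZE \<open>z \<in> Z\<close> by blast
    have "j * d \<le> M * d" using j d1 by simp
    moreover have "0 < j * d" using j d1 by simp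
    ultimately show ?thesis using j Md pk by linarith
  qed

  have disj: "X \<inter> Y = {}" "X \<inter> Z = {}" "Y \<inter> Z = {}"
  proof -
    have "x \<notin> Y" if "x \<in> X" for x using that Xb[of x] Yb[of x] by linarith
    then show "X \<inter> Y = {}" by blast
    have "x \<notin> Z" if "x \<in> X" for x using that Xb[of x] Zb[of x] by linarith
    then show "X \<inter> Z = {}" by blast
    have "x \<notin> Z" if "x \<in> Y" for x using that Yb[of x] Zb[of x] by linarith
    then show "Y \<inter> Z = {}" by blast
  qed

  have "finite B"
  proof -
    have "X \<subseteq> (\<lambda>j. 2 ^ n - 2 ^ j) ` {..n}" using XE by blast
    then have X: "finite X" by (rule finite_subset) simp
    have "Y \<subseteq> (\<lambda>x. m - x) ` X" using YE by blast
    then have Y: "finite Y" by (rule finite_subset) (simp add: X)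
    have "Z \<subseteq> (\<lambda>j. 2 ^ n + j * d) ` {1..M}"
    proof
      fix z assume "z \<in> Z"
      then obtain j where "1 \<le> j" "j \<le> M" "z = 2 ^ n + j * d" using ZE by blast
      then show "z \<in> (\<lambda>j. 2 ^ n + j * d) ` {1..M}" by (intro image_eqI[of _ _ j]) auto
    qed
    then have Z: "finite Z" by (rule finite_subset) simp
    show ?thesis using X Y Z assms(9) by simp
  qed
  have B0: "0 \<in> B" using X0 XB by blast

  \<comment> \<open>Minimum and greatest common divisor\<close>
  have norm: "normalised A"
  proof -
    have Apos: "0 \<le> x" if "x \<in> A" for x
    proof -
      have p: "(0::int) < 2 ^ n" by simp
      have "x \<in> X \<or> x \<in> Y \<or> x \<in> Z \<or> x = 2 ^ n"
        using that assms(9-11) by blast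
      then show ?thesis using Xb[of x] Yb[of x] Zb[of x] p by linarith
    qed
    have fA: "finite A" and A0: "0 \<in> A" using \<open>finite B\<close> B0 assms(11) by auto
    have "Min A = 0" using Min_eqI[OF fA Apos A0] by simp
    moreover have "Gcd A = 1"
    proof -
      \<comment> \<open>The gcd divides \<open>a\<close> and the first term \<open>2 ^ n + d\<close>
        of \<open>Z\<close>, so it divides the coprime numbers \<open>2 ^ n\<close> and
        \<open>d\<close>.\<close>
      have "2 ^ n \<in> A" using assms(10,11) by simp
      then have g1: "Gcd A dvd 2 ^ n" by (rule Gcd_dvd)
      have "2 ^ n + 1 * d \<in> A" using ZI[of 1] M1 ZB assms(11) by auto
      then have "Gcd A dvd 2 ^ n + 1 * d" by (rule Gcd_dvd)
      then have "Gcd A dvd d" using g1 by (simp add: dvd_add_right_iff)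
      then have "is_unit (Gcd A)" using g1 cop coprime_common_divisor by blast
      then show ?thesis using Gcd_int_greater_eq_0[of A] by simp
    qed
    ultimately show ?thesis using fA A0 by (auto simp: normalised_def)
  qed

  \<comment> \<open>Reflection in \<open>m\<close>\<close>
  have sym: "m - b \<in> B" if "b \<in> B" for b
  proof -
    consider "b \<in> X" | "b \<in> Y" | "b \<in> Z" using \<open>b \<in> B\<close> assms(9) by blast
    then show ?thesis
    proof cases
      case 1
      then show ?thesis using YI YB by blast
    next
      case 2
      then obtain x where "x \<in> X" "b = m - x" using YE by blast
      then show ?thesis using XB by auto
    next
      case 3
      then obtain j where j: "1 \<le> j" "j \<le> M" "b = 2 ^ n + j * d" using ZE by blast
      \<comment> \<open>As \<open>m = 2 * 2 ^ n + (M + 1) * d\<close>, reflection reverses the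
        progression \<open>Z\<close>.\<close>
      have "m - b = 2 ^ n + (M + 1 - j) * d"
        by (simp add: m j(3) algebra_simps)
      moreover have "2 ^ n + (M + 1 - j) * d \<in> Z" using j ZI by simp
      ultimately show ?thesis using ZB by auto
    qed
  qed

  \<comment> \<open>Sums with \<open>a\<close>\<close>
  have add: "a + b \<in> sumset B" if "b \<in> B" for b
  proof -
    consider "b \<in> X" | "b \<in> Y" | "b \<in> Z" using \<open>b \<in> B\<close> assms(9) by blast
    then show ?thesis
    proof cases
      case 1
      then obtain j where j: "k \<le> j" "j \<le> n" "b = 2 ^ n - 2 ^ j" using XE by blast
      \<comment> \<open>In general \<open>a + b\<close> is twice the element of \<open>X\<close>
        with exponent \<open>j - 1\<close>. For \<open>j = k\<close> that exponent is out of range,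
        but then \<open>a + b\<close> is the last term of \<open>Z\<close>.\<close>
      show ?thesis
      proof (cases "j = k")
        case True
        have "2 ^ n + M * d \<in> B" using ZI[of M] M1 ZB by auto
        with B0 show ?thesis by (rule sumsetI) (simp add: a j(3) True Md)
      next
        case False
        then obtain i where i: "j = Suc i" "k \<le> i" using j by (cases j) auto
        then have x: "2 ^ n - 2 ^ i \<in> B" using XI[of i] j XB by auto
        show ?thesis by (rule sumsetI[OF x x]) (simp add: a j(3) i(1))
      qed
    next
      case 2
      then obtain x where "x \<in> X" "b = m - x" using YE by blast
      then obtain j where j: "k \<le> j" "j \<le> n" "b = m - (2 ^ n - 2 ^ j)" using XE by blast
      \<comment> \<open>Here \<open>a + b = m + 2 ^ j\<close>, and
        \<open>2 ^ j = 2 ^ Suc j - 2 ^ j\<close> suggests the exponents \<open>j\<close> in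
        \<open>X\<close> and \<open>Suc j\<close> in \<open>Y\<close>. For \<open>j = n\<close> the
        last term of \<open>Z\<close> and the least element of \<open>Y\<close> serve
        instead.\<close>
      show ?thesis
      proof (cases "j = n")
        case True
        have z: "2 ^ n + M * d \<in> B" using ZI[of M] M1 ZB by auto
        have y: "m - (2 ^ n - 2 ^ k) \<in> B" using YI[OF XI[of k]] kn YB by auto
        show ?thesis by (rule sumsetI[OF z y]) (simp add: a j(3) True Md)
      next
        case False
        then have x: "2 ^ n - 2 ^ j \<in> B" using XI[of j] j XB by auto
        have y: "m - (2 ^ n - 2 ^ Suc j) \<in> B" using YI[OF XI[of "Suc j"]] j False YB by auto
        show ?thesis by (rule sumsetI[OF x y]) (simp add: a j(3))
      qed
    next
      case 3
      then obtain j where j: "1 \<le> j" "j \<le> M" "b = 2 ^ n + j * d" using ZE by blast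
      \<comment> \<open>One step \<open>d\<close> is moved from \<open>b\<close> to
        \<open>a\<close>, giving two terms of \<open>Z\<close>. For \<open>j = 1\<close> nothing
        would remain, but \<open>a + b = 2 * 2 ^ n + d\<close> is the least element of
        \<open>Y\<close>.\<close>
      show ?thesis
      proof (cases "j = 1")
        case True
        have y: "m - (2 ^ n - 2 ^ k) \<in> B" using YI[OF XI[of k]] kn YB by auto
        show ?thesis by (rule sumsetI[OF B0 y]) (simp add: a j(3) True m Md)
      next
        case False
        have z: "2 ^ n + 1 * d \<in> B" "2 ^ n + (j - 1) * d \<in> B"
          using ZI[of 1] ZI[of "j - 1"] M1 ZB j False by auto
        show ?thesis by (rule sumsetI[OF z]) (simp add: a j(3) algebra_simps)
      qed
    qed
  qed

  \<comment> \<open>The new sum \<open>2 * a\<close>\<close>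
  have dbl: "2 * a \<notin> sumset B"
  proof
    have XZ: False if "x \<in> X" "z \<in> Z" "x + z = 2 * a" for x z
    proof -
      obtain j where j: "x = 2 ^ n - 2 ^ j" using XE \<open>x \<in> X\<close> by blast
      obtain i where i: "z = 2 ^ n + i * d" using ZE \<open>z \<in> Z\<close> by blast
      have "2 ^ j = i * d" using that(3) a i j by simp
      then have "d dvd 2 ^ j" by simp
      then have "is_unit d" using coprime_common_divisor[OF cop dvd_refl] by blast
      then show False using d1 by simp
    qed
    assume "2 * a \<in> sumset B"
    then obtain x y where xy: "x \<in> B" "y \<in> B" "x + y = 2 * a"
      by (auto simp: sumset_def)
    have nonneg: "0 \<le> b" if "b \<in> B" for b
      using that norm \<open>finite B\<close> assms(11) Min_le[of A b] by (simp add: normalised_def)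
    \<comment> \<open>An element of \<open>Y\<close> alone exceeds \<open>2 * a\<close>. Two
      elements of \<open>X\<close> add up to less and two of \<open>Z\<close> to more, so only the
      mixed case \<open>XZ\<close> remains.\<close>
    have "x \<notin> Y" "y \<notin> Y"
      using Yb[of x] Yb[of y] nonneg[OF xy(1)] nonneg[OF xy(2)] xy(3) a by auto
    then have "x \<in> X \<or> x \<in> Z" "y \<in> X \<or> y \<in> Z" using xy assms(9) by auto
    then show False
      using XZ[of x y] XZ[of y x] Xb[of x] Xb[of y] Zb[of x] Zb[of y] xy(3) a by linarith
  qed

  have "card (sumset A) = card (diffset A) + 1"
    using card_sumset_insert_symmetric[OF \<open>finite B\<close> _ sym add dbl] B0 assms(11) by auto
  then show ?thesis using disj norm by simp
qed

end
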